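(* Let $S$ be a left cancellative semigroup with unit. Embed $\ell^2(S)$ in $\ell^2(S^* )$ by $\delta_s\mapsto\delta_{v_s}$, $s\in S$. The left regular representation $V$ of the inverse semigroup $S^*$ restricts to a *-representation on $\ell^2(S)\subset\ell^2(S^* )$. This subrepresentation coincides with the *-representation $V'$ of $S^*$ on $\ell^2(S)$ induced by the left regular representation of $S$, and its image is $I_l(S)$ (represented on $\ell^2(S)$).
   Context: $S^*$ is the universal inverse semigroup of $S$: the inverse semigroup generated by elements $v_p$ ($p\in S$) subject to $v_pv_q=v_{pq}$ and $v_p^*v_p=1$ (i.e. the quotient of the free inverse semigroup on $\{v_p: p\in S\}$ by the congruence generated by these relations, $v_1=1$). The left regular representation $V\colon P\to B(\ell^2(P))$ of an inverse semigroup $P$ is $V_s\delta_t=\delta_{st}$ if $s^*st=t$, and $V_s\delta_t=0$ otherwise. The left regular representation of $S$ on $\ell^2(S)$ is $V_p\delta_q=\delta_{pq}$; each $V_p$ is an isometry and the operators $V_p,V_p^*$ generate an inverse semigroup of partial isometries. $V'$ is the unital *-representation of $S^*$ on $\ell^2(S)$ determined by $V'(v_p)\delta_q=\delta_{pq}$ (so $V'(v_p^* )=V_p^*$). $I_l(S)$, the left inverse hull of $S$, is the inverse semigroup of partial bijections of $S$ generated by the left translations $\lambda_a\colon S\to S$, $\lambda_a(b)=ab$, and their inverses $\lambda_a^{-1}\colon aS\to S$. A partial bijection $f$ of $S$ is represented on $\ell^2(S)$ by $\delta_x\mapsto\delta_{f(x)}$ for $x$ in the domain of $f$, and $\delta_x\mapsto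 0$ otherwise. *)

theory Defs
  imports "HOL-Analysis.Analysis"
begin

section \<open>Inverse semigroups\<close>

class inverse_semigroup = semigroup_mult +
  fixes star :: "'a \<Rightarrow> 'a"
  assumes star_regular: "x * star x * x = x"
    and star_regular': "star x * x * star x = star x"
    and star_unique: "x * y * x = x \<Longrightarrow> y * x * y = y \<Longrightarrow> y = star x"


section \<open>The universal inverse semigroup of a monoid\<close>

datatype 'a iterm = Gen 'a | Mul "'a iterm" "'a iterm" | Star "'a iterm"

text \<open>
  \<open>univ_rel\<close> is the equational theory of inverse semigroups, presented as the variety of
  semigroups with involution satisfying \<open>x x\<^sup>* x = x\<close> and \<open>x x\<^sup>* y y\<^sup>* = y y\<^sup>* x x\<^sup>*\<close>
  (\<open>refl\<close> up to \<open>proj_commute\<close>; without the last four rules the quotient is the free inverse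
  semigroup), together with the defining relations. The unit is \<open>v\<^sub>1\<close>.
\<close>

inductive univ_rel :: "'a::monoid_mult iterm \<Rightarrow> 'a iterm \<Rightarrow> bool" where
  refl: "univ_rel s s"
| sym: "univ_rel s t \<Longrightarrow> univ_rel t s"
| trans: "univ_rel s t \<Longrightarrow> univ_rel t u \<Longrightarrow> univ_rel s u"
| cong_Mul: "univ_rel s s' \<Longrightarrow> univ_rel t t' \<Longrightarrow> univ_rel (Mul s t) (Mul s' t')"
| cong_Star: "univ_rel s s' \<Longrightarrow> univ_rel (Star s) (Star s')"
| assoc: "univ_rel (Mul (Mul s t) u) (Mul s (Mul t u))"
| Star_Star: "univ_rel (Star (Star s)) s"
| Star_Mul: "univ_rel (Star (Mul s t)) (Mul (Star t) (Star s))"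
| regular: "univ_rel (Mul (Mul s (Star s)) s) s"
| proj_commute:
    "univ_rel (Mul (Mul s (Star s)) (Mul t (Star t))) (Mul (Mul t (Star t)) (Mul s (Star s)))"
| Gen_Mul: "univ_rel (Mul (Gen p) (Gen q)) (Gen (p * q))"
| Gen_isometry: "univ_rel (Mul (Star (Gen p)) (Gen p)) (Gen 1)"
| unit_left: "univ_rel (Mul (Gen 1) s) s"
| unit_right: "univ_rel (Mul s (Gen 1)) s"

quotient_type (overloaded) 'a univ_inv = "'a::monoid_mult iterm" / univ_rel
  by (intro equivpI reflpI sympI transpI) (fact univ_rel.refl univ_rel.sym univ_rel.trans)+

lift_definition v :: "'a::monoid_mult \<Rightarrow> 'a univ_inv" is Gen .

instantiation univ_inv :: (monoid_mult) "{monoid_mult, inverse_semigroup}"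
begin

lift_definition times_univ_inv :: "'a univ_inv \<Rightarrow> 'a univ_inv \<Rightarrow> 'a univ_inv" is Mul
  by (rule univ_rel.cong_Mul)

lift_definition one_univ_inv :: "'a univ_inv" is "Gen 1" .

lift_definition star_univ_inv :: "'a univ_inv \<Rightarrow> 'a univ_inv" is Star
  by (rule univ_rel.cong_Star)

instance
proof
  fix x y z :: "'a univ_inv"
  have assoc: "a * b * c = a * (b * c)" for a b c :: "'a univ_inv"
    by transfer (rule univ_rel.assoc)
  have inv_inv: "star (star a) = a" for a :: "'a univ_inv"
    by transfer (rule univ_rel.Star_Star)
  have inv_mult: "star (a * b) = star b * star a" for a b :: "'a univ_inv"
    by transfer (rule univ_rel.Star_Mul)
  have reg: "a * (star a * a) = a" for a :: "'a univ_inv"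
    using assoc[of a "star a" a] by transfer (metis univ_rel.regular univ_rel.sym univ_rel.trans)
  have reg': "star a * (a * star a) = star a" for a :: "'a univ_inv"
    using reg[of "star a"] by (simp add: inv_inv)
  have proj: "(a * star a) * (b * star b) = (b * star b) * (a * star a)" for a b :: "'a univ_inv"
    by transfer (rule univ_rel.proj_commute)
  have idem: "e * star e = e" if e: "e * e = e" for e :: "'a univ_inv"
  proof -
    have ee: "star e * star e = star e" by (metis e inv_mult)
    have "e = e * (star e * e) * (e * (star e * e))" by (simp only: reg e)
    also have "\<dots> = e * ((star e * star (star e)) * (e * star e)) * e"
      by (simp only: assoc inv_inv)
    also have "\<dots> = e * ((e * star e) * (star e * star (star e))) * e"
      by (simp only: proj)
    also have "\<dots> = (e * e) * (star e * star e) * (e * e)"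
      by (simp only: assoc inv_inv)
    also have "\<dots> = (e * star e) * (star e * star (star e))"
      by (simp only: e ee assoc inv_inv) (metis assoc ee)
    finally have a: "e = (e * star e) * (star e * star (star e))" .
    have "star e = (star (star e) * star (star e) * star e) * (e * star e) "
      using reg'
      by (metis a assoc inv_inv inv_mult proj)
    then have "star e = e" by (metis a assoc inv_inv inv_mult proj)
    then show ?thesis using e by simp
  qed
  have idem_comm: "e * f = f * e" if "e * e = e" "f * f = f" for e f :: "'a univ_inv"
    using proj[of e f] idem[OF that(1)] idem[OF that(2)] by simp
  show "x * y * z = x * (y * z)" by (rule assoc)
  show "1 * x = x" by transfer (rule univ_rel.unit_left)
  show "x * 1 = x" by transfer (rule univ_rel.unit_right)
  show "x * star x * x = x" by (simp add: assoc reg)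
  show "star x * x * star x = star x" by (simp add: assoc reg')
  assume x: "x * y * x = x" and y: "y * x * y = y"
  have c1: "(x * y) * (x * star x) = (x * star x) * (x * y)"
    by (rule idem_comm) (metis assoc x, metis assoc reg)
  have c2: "(y * x) * (star x * x) = (star x * x) * (y * x)"
    by (rule idem_comm) (metis assoc x, metis assoc reg)
  have "y = y * ((x * star x) * (x * y))" by (metis assoc reg y)
  also have "\<dots> = y * ((x * y) * (x * star x))" by (simp only: c1)
  also have "\<dots> = (y * x * y) * (x * star x)" by (simp only: assoc)
  also have "\<dots> = y * (x * star x)" by (simp only: y)
  also have "\<dots> = (y * x) * (star x * x) * star x" by (simp only: assoc reg' reg)
  also have "\<dots> = (star x * x) * (y * x) * star x" by (simp only: c2)
  also have "\<dots> = star x * (x * y * x) * star x" by (simp only: assoc)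
  also have "\<dots> = star x" unfolding x by (simp only: assoc reg')
  finally show "y = star x" .
qed

end


section \<open>The Hilbert space \<open>\<ell>\<^sup>2(X)\<close>\<close>

typedef 'x ell2 = "{f :: 'x \<Rightarrow> complex. (\<lambda>x. (cmod (f x))\<^sup>2) summable_on UNIV}"
  by (rule exI[of _ "\<lambda>_. 0"]) simp

setup_lifting type_definition_ell2

lemma ell2_summable_mult:
  fixes f g :: "'x \<Rightarrow> complex"
  assumes "(\<lambda>x. (cmod (f x))\<^sup>2) summable_on UNIV" "(\<lambda>x. (cmod (g x))\<^sup>2) summable_on UNIV"
  shows "(\<lambda>x. f x * g x) summable_on UNIV"
proof (rule abs_summable_summable)
  have "(\<lambda>x. (cmod (f x))\<^sup>2 + (cmod (g x))\<^sup>2) summable_on UNIV"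
    using assms by (rule summable_on_add)
  then show "(\<lambda>x. norm (f x * g x)) summable_on UNIV"
  proof (rule summable_on_comparison_test)
    fix x
    have "0 \<le> (cmod (f x) - cmod (g x))\<^sup>2" "0 \<le> cmod (f x) * cmod (g x)" by simp_all
    then show "norm (f x * g x) \<le> (cmod (f x))\<^sup>2 + (cmod (g x))\<^sup>2"
      unfolding norm_mult power2_diff by linarith
  qed auto
qed

lemma ell2_summable_add:
  fixes f g :: "'x \<Rightarrow> complex"
  assumes "(\<lambda>x. (cmod (f x))\<^sup>2) summable_on UNIV" "(\<lambda>x. (cmod (g x))\<^sup>2) summable_on UNIV"
  shows "(\<lambda>x. (cmod (f x + g x))\<^sup>2) summable_on UNIV"
proof -
  have "(\<lambda>x. 2 * (cmod (f x))\<^sup>2 + 2 * (cmod (g x))\<^sup>2) summable_on UNIV"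
    using assms by (intro summable_on_add summable_on_cmult_right)
  then show ?thesis
  proof (rule summable_on_comparison_test)
    fix x
    have "(cmod (f x + g x))\<^sup>2 \<le> (cmod (f x) + cmod (g x))\<^sup>2"
      by (intro power_mono norm_triangle_ineq norm_ge_zero)
    moreover have "0 \<le> (cmod (f x) - cmod (g x))\<^sup>2" by simp
    ultimately show "(cmod (f x + g x))\<^sup>2 \<le> 2 * (cmod (f x))\<^sup>2 + 2 * (cmod (g x))\<^sup>2"
      by (simp add: power2_sum power2_diff)
  qed auto
qed

lemma ell2_summable_scale:
  fixes f :: "'x \<Rightarrow> complex"
  assumes "(\<lambda>x. (cmod (f x))\<^sup>2) summable_on UNIV"
  shows "(\<lambda>x. (cmod (c * f x))\<^sup>2) summable_on UNIV"
  using summable_on_cmult_right[OF assms, of "(cmod c)\<^sup>2"] by (simp add: norm_mult power_mult_distrib)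

lift_definition scaleC :: "complex \<Rightarrow> 'x ell2 \<Rightarrow> 'x ell2" is "\<lambda>c f x. c * f x"
  by (rule ell2_summable_scale)

lift_definition cinner :: "'x ell2 \<Rightarrow> 'x ell2 \<Rightarrow> complex" is
  "\<lambda>f g. \<Sum>\<^sub>\<infinity>x. cnj (f x) * g x" .

lift_definition delta :: "'x \<Rightarrow> 'x ell2" is "\<lambda>x y. of_bool (y = x)"
proof -
  fix x :: 'x
  have "(\<lambda>y. (cmod (of_bool (y = x)))\<^sup>2) summable_on {x}" by simp
  then show "(\<lambda>y. (cmod (of_bool (y = x)))\<^sup>2) summable_on UNIV"
    by (subst summable_on_cong_neutral[where T = "{x}"]) auto
qed

instantiation ell2 :: (type) real_inner
begin

lift_definition zero_ell2 :: "'a ell2" is "\<lambda>_. 0" by simp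

lift_definition plus_ell2 :: "'a ell2 \<Rightarrow> 'a ell2 \<Rightarrow> 'a ell2" is "\<lambda>f g x. f x + g x"
  by (rule ell2_summable_add)

lift_definition uminus_ell2 :: "'a ell2 \<Rightarrow> 'a ell2" is "\<lambda>f x. - f x" by simp

definition minus_ell2 :: "'a ell2 \<Rightarrow> 'a ell2 \<Rightarrow> 'a ell2" where
  "minus_ell2 f g = f + (- g)"

definition scaleR_ell2 :: "real \<Rightarrow> 'a ell2 \<Rightarrow> 'a ell2" where
  "scaleR_ell2 r f = scaleC (complex_of_real r) f"

definition inner_ell2 :: "'a ell2 \<Rightarrow> 'a ell2 \<Rightarrow> real" where
  "inner_ell2 f g = Re (cinner f g)"

lift_definition norm_ell2 :: "'a ell2 \<Rightarrow> real" is "\<lambda>f. sqrt (\<Sum>\<^sub>\<infinity>x. (cmod (f x))\<^sup>2)" .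

definition sgn_ell2 :: "'a ell2 \<Rightarrow> 'a ell2" where
  "sgn_ell2 f = inverse (norm f) *\<^sub>R f"

definition dist_ell2 :: "'a ell2 \<Rightarrow> 'a ell2 \<Rightarrow> real" where
  "dist_ell2 f g = norm (f - g)"

definition uniformity_ell2 :: "('a ell2 \<times> 'a ell2) filter" where
  "uniformity_ell2 = (INF e\<in>{0<..}. principal {(x, y). dist x y < e})"

definition open_ell2 :: "'a ell2 set \<Rightarrow> bool" where
  "open_ell2 U \<longleftrightarrow> (\<forall>x\<in>U. \<forall>\<^sub>F (x', y) in uniformity. x' = x \<longrightarrow> y \<in> U)"

instance
proof
  fix f g h :: "'a ell2" and r s :: real
  show "f + g + h = f + (g + h)" by transfer (simp add: add.assoc)
  show "f + g = g + f" by transfer (simp add: add.commute)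
  show "0 + f = f" by transfer simp
  show "- f + f = 0" by transfer simp
  show "f - g = f + - g" by (simp add: minus_ell2_def)
  show "r *\<^sub>R (f + g) = r *\<^sub>R f + r *\<^sub>R g"
    unfolding scaleR_ell2_def by transfer (simp add: algebra_simps)
  show "(r + s) *\<^sub>R f = r *\<^sub>R f + s *\<^sub>R f"
    unfolding scaleR_ell2_def by transfer (simp add: algebra_simps)
  show "r *\<^sub>R s *\<^sub>R f = (r * s) *\<^sub>R f"
    unfolding scaleR_ell2_def by transfer (simp add: algebra_simps)
  show "1 *\<^sub>R f = f"
    unfolding scaleR_ell2_def by transfer simp
  show "sgn f = inverse (norm f) *\<^sub>R f" by (simp add: sgn_ell2_def)
  show "dist f g = norm (f - g)" by (simp add: dist_ell2_def)
  show "uniformity = (INF e\<in>{0<..}. principal {(x :: 'a ell2, y). dist x y < e})"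
    by (simp add: uniformity_ell2_def)
  show "open U \<longleftrightarrow> (\<forall>x\<in>U. \<forall>\<^sub>F (x', y) in uniformity. x' = x \<longrightarrow> y \<in> U)" for U :: "'a ell2 set"
    by (simp add: open_ell2_def)
  have self: "inner f f = (\<Sum>\<^sub>\<infinity>x. (cmod (Rep_ell2 f x))\<^sup>2)" for f :: "'a ell2"
  proof -
    have "(\<lambda>x. cnj (Rep_ell2 f x) * Rep_ell2 f x) summable_on UNIV"
      using Rep_ell2[of f] by (intro ell2_summable_mult) auto
    then have "inner f f = (\<Sum>\<^sub>\<infinity>x. Re (cnj (Rep_ell2 f x) * Rep_ell2 f x))"
      unfolding inner_ell2_def cinner.rep_eq by (rule infsum_Re[symmetric])
    moreover have "Re (cnj z * z) = (cmod z)\<^sup>2" for z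
      by (simp only: cmod_power2) (simp add: power2_eq_square)
    ultimately show ?thesis by simp
  qed
  have "cinner g f = cnj (cinner f g)"
    by transfer (simp flip: infsum_cnj add: mult.commute)
  then show "inner f g = inner g f" by (simp add: inner_ell2_def)
  have "cinner (f + g) h = cinner f h + cinner g h"
  proof transfer
    fix f g h :: "'a \<Rightarrow> complex"
    assume a: "(\<lambda>x. (cmod (f x))\<^sup>2) summable_on UNIV" "(\<lambda>x. (cmod (g x))\<^sup>2) summable_on UNIV"
      "(\<lambda>x. (cmod (h x))\<^sup>2) summable_on UNIV"
    show "(\<Sum>\<^sub>\<infinity>x. cnj (f x + g x) * h x) = (\<Sum>\<^sub>\<infinity>x. cnj (f x) * h x) + (\<Sum>\<^sub>\<infinity>x. cnj (g x) * h x)"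
      by (subst infsum_add[symmetric])
         (use a in \<open>auto intro!: ell2_summable_mult simp: algebra_simps\<close>)
  qed
  then show "inner (f + g) h = inner f h + inner g h" by (simp add: inner_ell2_def)
  have "cinner (scaleC (of_real r) f) g = of_real r * cinner f g"
    by transfer (simp add: mult.assoc infsum_cmult_right')
  then show "inner (r *\<^sub>R f) g = r * inner f g" by (simp add: inner_ell2_def scaleR_ell2_def)
  show "0 \<le> inner f f" by (simp add: self infsum_nonneg)
  show "norm f = sqrt (inner f f)" by (simp add: self norm_ell2.rep_eq)
  show "inner f f = 0 \<longleftrightarrow> f = 0"
  proof
    assume "inner f f = 0"
    then have "(cmod (Rep_ell2 f x))\<^sup>2 = 0" for x
      using Rep_ell2[of f]
      by (intro nonneg_infsum_le_0D[where f = "\<lambda>x. (cmod (Rep_ell2 f x))\<^sup>2" and A = UNIV])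
         (auto simp: self)
    then show "f = 0" by transfer auto
  next
    assume "f = 0"
    then show "inner f f = 0" by (simp add: self zero_ell2.rep_eq)
  qed
qed

end


section \<open>Operators and *-representations\<close>

definition bounded_op :: "('x ell2 \<Rightarrow> 'y ell2) \<Rightarrow> bool" where
  "bounded_op T \<longleftrightarrow> bounded_linear T \<and> (\<forall>c \<xi>. T (scaleC c \<xi>) = scaleC c (T \<xi>))"

definition star_rep :: "('p::inverse_semigroup \<Rightarrow> 'x ell2 \<Rightarrow> 'x ell2) \<Rightarrow> bool" where
  "star_rep \<pi> \<longleftrightarrow>
     (\<forall>s. bounded_op (\<pi> s)) \<and>
     (\<forall>s t. \<pi> (s * t) = \<pi> s \<circ> \<pi> t) \<and>
     (\<forall>s \<xi> \<eta>. cinner (\<pi> s \<xi>) \<eta> = cinner \<xi> (\<pi> (star s) \<eta>))"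

text \<open>
  \<open>partial_op f\<close> is the operator \<open>\<delta>\<^sub>x \<mapsto> \<delta>\<^bsub>f x\<^esub>\<close> if \<open>f x\<close> is defined, \<open>\<delta>\<^sub>x \<mapsto> 0\<close> otherwise;
  it exists and is unique when \<open>f\<close> is injective on its domain (\<open>partial_op_ex1\<close> below).
\<close>

definition is_partial_op :: "('x \<Rightarrow> 'y option) \<Rightarrow> ('x ell2 \<Rightarrow> 'y ell2) \<Rightarrow> bool" where
  "is_partial_op f T \<longleftrightarrow> bounded_op T \<and>
     (\<forall>x. T (delta x) = (case f x of None \<Rightarrow> 0 | Some y \<Rightarrow> delta y))"

definition partial_op :: "('x \<Rightarrow> 'y option) \<Rightarrow> 'x ell2 \<Rightarrow> 'y ell2" where
  "partial_op f = (THE T. is_partial_op f T)"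

definition left_regular :: "'p::inverse_semigroup \<Rightarrow> 'p ell2 \<Rightarrow> 'p ell2" where
  "left_regular s = partial_op (\<lambda>t. if star s * s * t = t then Some (s * t) else None)"

text \<open>
  The representation \<open>V'\<close> of \<open>S\<^sup>*\<close> on \<open>\<ell>\<^sup>2(S)\<close>; it exists and is unique when the monoid is left
  cancellative (\<open>induced_rep_ex1\<close> below).
\<close>

definition is_induced_rep ::
  "('a::monoid_mult univ_inv \<Rightarrow> 'a ell2 \<Rightarrow> 'a ell2) \<Rightarrow> bool" where
  "is_induced_rep \<pi> \<longleftrightarrow> star_rep \<pi> \<and> \<pi> 1 = id \<and> (\<forall>p q. \<pi> (v p) (delta q) = delta (p * q))"

definition induced_rep :: "'a::monoid_mult univ_inv \<Rightarrow> 'a ell2 \<Rightarrow> 'a ell2" where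
  "induced_rep = (THE \<pi>. is_induced_rep \<pi>)"

text \<open>
  The subspace \<open>\<ell>\<^sup>2(S)\<close> of \<open>\<ell>\<^sup>2(S\<^sup>*)\<close> is the range of \<open>l2_embed\<close>, and \<open>restrict_rep \<pi>\<close> is the
  restriction of \<open>\<pi>\<close> to it, transported to \<open>\<ell>\<^sup>2(S)\<close> (meaningful if the range is invariant).
\<close>

definition l2_embed :: "'a::monoid_mult ell2 \<Rightarrow> 'a univ_inv ell2" where
  "l2_embed = partial_op (\<lambda>s. Some (v s))"

definition restrict_rep ::
  "('p \<Rightarrow> 'a::monoid_mult univ_inv ell2 \<Rightarrow> 'a univ_inv ell2) \<Rightarrow> 'p \<Rightarrow> 'a ell2 \<Rightarrow> 'a ell2" where
  "restrict_rep \<pi> s = inv l2_embed \<circ> \<pi> s \<circ> l2_embed"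


section \<open>The left inverse hull\<close>

definition partial_inv :: "('x \<Rightarrow> 'y option) \<Rightarrow> 'y \<Rightarrow> 'x option" where
  "partial_inv f y = (if y \<in> ran f then Some (THE x. f x = Some y) else None)"

definition left_trans :: "'a::times \<Rightarrow> 'a \<Rightarrow> 'a option" where
  "left_trans a b = Some (a * b)"

inductive_set left_inverse_hull :: "('a::times \<Rightarrow> 'a option) set" where
  left_trans: "left_trans a \<in> left_inverse_hull"
| inverse: "f \<in> left_inverse_hull \<Longrightarrow> partial_inv f \<in> left_inverse_hull"
| comp: "f \<in> left_inverse_hull \<Longrightarrow> g \<in> left_inverse_hull \<Longrightarrow> f \<circ>\<^sub>m g \<in> left_inverse_hull"

section \<open>Well-definedness of \<open>partial_op\<close> and \<open>induced_rep\<close>\<close>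

lemma bounded_op_compose: "bounded_op S \<Longrightarrow> bounded_op T \<Longrightarrow> bounded_op (S \<circ> T)"
  unfolding bounded_op_def comp_def using bounded_linear_compose by auto

lemma scaleC_zero: "scaleC c 0 = 0" by transfer simp

lemma norm_ell2_sq: "(norm \<xi>)\<^sup>2 = (\<Sum>\<^sub>\<infinity>x. (cmod (Rep_ell2 \<xi> x))\<^sup>2)"
  by (simp add: norm_ell2.rep_eq infsum_nonneg)

lift_definition trunc :: "'x set \<Rightarrow> 'x ell2 \<Rightarrow> 'x ell2" is "\<lambda>F f x. if x \<in> F then f x else 0"
  by (erule summable_on_comparison_test) auto

lemma trunc_insert: "x \<notin> F \<Longrightarrow> trunc (insert x F) \<xi> = trunc F \<xi> + scaleC (Rep_ell2 \<xi> x) (delta x)"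
  by transfer auto

lemma trunc_empty: "trunc {} \<xi> = 0" by transfer simp

lemma trunc_approx:
  assumes "e > 0" shows "\<exists>F. finite F \<and> norm (\<xi> - trunc F \<xi>) < e"
proof -
  let ?g = "\<lambda>x. (cmod (Rep_ell2 \<xi> x))\<^sup>2"
  have s: "?g summable_on UNIV" using Rep_ell2[of \<xi>] by simp
  have e2: "e^2 / 2 > 0" "e^2 / 2 < e^2" using assms by simp_all
  obtain F where F: "finite F" "dist (sum ?g F) (infsum ?g UNIV) \<le> e^2 / 2"
    using infsum_finite_approximation[OF s e2(1)] by blast
  have "(norm (\<xi> - trunc F \<xi>))\<^sup>2 = (\<Sum>\<^sub>\<infinity>x. if x \<in> F then 0 else ?g x)"
    unfolding norm_ell2_sq minus_ell2_def plus_ell2.rep_eq uminus_ell2.rep_eq trunc.rep_eq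
    by (intro infsum_cong) auto
  also have "\<dots> = infsum ?g (UNIV - F)"
    by (rule infsum_cong_neutral) auto
  also have "\<dots> = infsum ?g UNIV - sum ?g F"
    using infsum_Diff[OF s, of F] F(1) by simp
  also have "\<dots> < e^2" using F(2) e2(2) unfolding dist_real_def by linarith
  finally show ?thesis using F(1) assms power_less_imp_less_base[of "norm (\<xi> - trunc F \<xi>)" 2 e] by auto
qed

lemma bounded_op_eqI:
  assumes S: "bounded_op S" and T: "bounded_op T" and eq: "\<And>x. S (delta x) = T (delta x)"
  shows "S = T"
proof
  fix \<xi>
  let ?D = "\<lambda>\<xi>. S \<xi> - T \<xi>"
  have bl: "bounded_linear ?D" using S T by (auto simp: bounded_op_def intro: bounded_linear_sub)
  then interpret bounded_linear ?D .
  have tr: "S (trunc F \<xi>) = T (trunc F \<xi>)" if "finite F" for F \<xi>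
    using that
  proof induction
    case empty
    show ?case using S T by (simp add: trunc_empty bounded_op_def linear_simps)
  next
    case (insert x F)
    then show ?case using S T
      by (simp add: trunc_insert bounded_op_def linear_simps eq)
  qed
  obtain K where K: "K > 0" "\<And>\<xi>. norm (?D \<xi>) \<le> norm \<xi> * K" using pos_bounded by blast
  have "norm (?D \<xi>) \<le> e" if "e > 0" for e
  proof -
    obtain F where F: "finite F" "norm (\<xi> - trunc F \<xi>) < e / K"
      using trunc_approx[of "e / K"] \<open>e > 0\<close> K(1) by auto
    have "?D \<xi> = ?D (\<xi> - trunc F \<xi>)" using tr[OF F(1)] by (simp add: diff)
    then have "norm (?D \<xi>) \<le> norm (\<xi> - trunc F \<xi>) * K" using K(2) by metis
    also have "\<dots> \<le> e" using F(2) K(1) by (simp add: field_simps)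
    finally show ?thesis .
  qed
  then have "norm (?D \<xi>) \<le> 0" by (rule field_le_epsilon) simp
  then show "S \<xi> = T \<xi>" by simp
qed

lemma partial_inv_eq_Some:
  assumes "inj_on f (dom f)"
  shows "partial_inv f y = Some x \<longleftrightarrow> f x = Some y"
proof -
  have "x = x'" if "f x = Some y" "f x' = Some y" for x x'
    using assms that by (auto simp: inj_on_def dom_def)
  then have the: "(THE x. f x = Some y) = x" if "f x = Some y" for x
    using that by (intro the_equality) auto
  show ?thesis
  proof
    assume "partial_inv f y = Some x"
    then obtain x' where "f x' = Some y" "x = (THE x. f x = Some y)"
      by (auto simp: partial_inv_def ran_def split: if_splits)
    then show "f x = Some y" using the by simp
  next
    assume "f x = Some y"
    then show "partial_inv f y = Some x" using the by (auto simp: partial_inv_def ran_def)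
  qed
qed

lemma partial_pullback:
  fixes f :: "'x \<Rightarrow> 'y option" and h :: "'x \<Rightarrow> 'b::{banach}"
  assumes inj: "inj_on f (dom f)" and s: "h summable_on UNIV"
  defines "k \<equiv> \<lambda>y. case partial_inv f y of None \<Rightarrow> 0 | Some x \<Rightarrow> h x"
  shows "k summable_on UNIV" "infsum k UNIV = infsum h (dom f)"
proof -
  have s': "h summable_on dom f" using s summable_on_subset_banach by blast
  have b: "bij_betw (\<lambda>x. the (f x)) (dom f) (ran f)"
    unfolding bij_betw_def using inj by (force simp: inj_on_def dom_def ran_def image_def)
  have k: "k (the (f x)) = h x" if d: "x \<in> dom f" for x
  proof -
    obtain y where y: "f x = Some y" using d by blast
    then have "partial_inv f y = Some x" using partial_inv_eq_Some[OF inj] by simp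
    then show ?thesis using y by (simp add: k_def)
  qed
  have k0: "k y = 0" if "y \<notin> ran f" for y using that by (simp add: k_def partial_inv_def)
  have "(\<lambda>x. k (the (f x))) summable_on dom f"
    using s' by (rule summable_on_cong[THEN iffD2, rotated]) (simp add: k)
  then have "k summable_on ran f" using summable_on_reindex_bij_betw[OF b, of k] by simp
  then show "k summable_on UNIV" by (rule summable_on_cong_neutral[THEN iffD1, rotated -1]) (auto simp: k0)
  have "infsum k UNIV = infsum k (ran f)" by (rule infsum_cong_neutral) (auto simp: k0)
  also have "\<dots> = infsum (\<lambda>x. k (the (f x))) (dom f)"
    using infsum_reindex_bij_betw[OF b, of k] by simp
  also have "\<dots> = infsum h (dom f)" by (rule infsum_cong) (simp add: k)
  finally show "infsum k UNIV = infsum h (dom f)" .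
qed

lemma partial_op_exists:
  fixes f :: "'x \<Rightarrow> 'y option"
  assumes inj: "inj_on f (dom f)"
  shows "\<exists>T. is_partial_op f T \<and>
    (\<forall>\<xi> y. Rep_ell2 (T \<xi>) y = (case partial_inv f y of None \<Rightarrow> 0 | Some x \<Rightarrow> Rep_ell2 \<xi> x))"
proof -
  define g where "g \<xi> y = (case partial_inv f y of None \<Rightarrow> 0 | Some x \<Rightarrow> Rep_ell2 \<xi> x)" for \<xi> y
  define T where "T \<xi> = Abs_ell2 (g \<xi>)" for \<xi>
  have sq: "(\<lambda>y. (cmod (g \<xi> y))\<^sup>2) = (\<lambda>y. case partial_inv f y of None \<Rightarrow> 0 | Some x \<Rightarrow> (cmod (Rep_ell2 \<xi> x))\<^sup>2)" for \<xi>
    by (auto simp: g_def fun_eq_iff split: option.splits)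
  have s: "(\<lambda>x. (cmod (Rep_ell2 \<xi> x))\<^sup>2) summable_on UNIV" for \<xi> using Rep_ell2[of \<xi>] by simp
  have Rep: "Rep_ell2 (T \<xi>) = g \<xi>" for \<xi>
    unfolding T_def using partial_pullback(1)[OF inj s] by (simp add: Abs_ell2_inverse sq)
  have add: "T (\<xi> + \<eta>) = T \<xi> + T \<eta>" for \<xi> \<eta>
    unfolding Rep_ell2_inject[symmetric] plus_ell2.rep_eq Rep
    by (auto simp: g_def plus_ell2.rep_eq fun_eq_iff split: option.splits)
  have scale: "T (scaleC c \<xi>) = scaleC c (T \<xi>)" for c \<xi>
    unfolding Rep_ell2_inject[symmetric] scaleC.rep_eq Rep
    by (auto simp: g_def scaleC.rep_eq fun_eq_iff split: option.splits)
  have "norm (T \<xi>) \<le> norm \<xi>" for \<xi>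
  proof -
    have "(norm (T \<xi>))\<^sup>2 = infsum (\<lambda>x. (cmod (Rep_ell2 \<xi> x))\<^sup>2) (dom f)"
      unfolding norm_ell2_sq Rep sq by (rule partial_pullback(2)[OF inj s])
    also have "\<dots> \<le> (norm \<xi>)\<^sup>2" unfolding norm_ell2_sq
      by (rule infsum_mono_neutral) (auto intro: s summable_on_subset_banach[OF s])
    finally show ?thesis by (simp add: power2_le_iff_abs_le)
  qed
  then have "bounded_op T"
    unfolding bounded_op_def by (auto intro!: bounded_linear_intro[where K = 1] simp: add scale scaleR_ell2_def)
  moreover have "T (delta x) = (case f x of None \<Rightarrow> 0 | Some y \<Rightarrow> delta y)" for x
  proof -
    have "g (delta x) y = Rep_ell2 (case f x of None \<Rightarrow> 0 | Some y \<Rightarrow> delta y) y" for y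
    proof (cases "partial_inv f y")
      case None
      then have "f x \<noteq> Some y" using partial_inv_eq_Some[OF inj, of y x] by simp
      then show ?thesis using None
        by (cases "f x") (auto simp: g_def delta.rep_eq zero_ell2.rep_eq)
    next
      case (Some x')
      then have "f x' = Some y" "f x = Some y \<longleftrightarrow> x' = x"
        using partial_inv_eq_Some[OF inj] by (metis, metis option.inject)
      then show ?thesis using Some
        by (cases "f x") (auto simp: g_def delta.rep_eq zero_ell2.rep_eq)
    qed
    then show ?thesis unfolding Rep_ell2_inject[symmetric] Rep by (rule ext)
  qed
  ultimately show ?thesis by (intro exI[of _ T]) (auto simp: is_partial_op_def Rep g_def)
qed

lemma partial_op_ex1:
  assumes "inj_on f (dom f)"
  shows "\<exists>!T. is_partial_op f T"
  using partial_op_exists[OF assms] bounded_op_eqI unfolding is_partial_op_def by metis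

abbreviation pinj :: "('x \<Rightarrow> 'y option) \<Rightarrow> bool" where "pinj f \<equiv> inj_on f (dom f)"

lemma pinjI: "(\<And>x x' y. f x = Some y \<Longrightarrow> f x' = Some y \<Longrightarrow> x = x') \<Longrightarrow> pinj f"
  unfolding inj_on_def dom_def by (metis (mono_tags, lifting) mem_Collect_eq not_None_eq)

lemma pinjD: "pinj f \<Longrightarrow> f x = Some y \<Longrightarrow> f x' = Some y \<Longrightarrow> x = x'"
  unfolding inj_on_def dom_def by (metis (mono_tags, lifting) mem_Collect_eq option.distinct(1))

lemma map_eqI: "(\<And>x y. f x = Some y \<longleftrightarrow> g x = Some y) \<Longrightarrow> f = g"
  by (rule ext) (metis not_Some_eq)

lemma pinj_comp: "pinj f \<Longrightarrow> pinj g \<Longrightarrow> pinj (f \<circ>\<^sub>m g)"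
  by (rule pinjI) (auto simp: map_comp_Some_iff dest: pinjD)

lemma pinj_inv: "pinj f \<Longrightarrow> pinj (partial_inv f)"
  by (rule pinjI) (simp add: partial_inv_eq_Some)

lemma inv_inv: "pinj f \<Longrightarrow> partial_inv (partial_inv f) = f"
  by (rule map_eqI) (simp add: partial_inv_eq_Some pinj_inv)

lemma is_partial_op: "pinj f \<Longrightarrow> is_partial_op f (partial_op f)"
  unfolding partial_op_def by (rule theI'[OF partial_op_ex1])

lemma bounded_partial_op: "pinj f \<Longrightarrow> bounded_op (partial_op f)"
  using is_partial_op is_partial_op_def by blast

lemma partial_op_delta: "pinj f \<Longrightarrow> partial_op f (delta x) = (case f x of None \<Rightarrow> 0 | Some y \<Rightarrow> delta y)"
  using is_partial_op is_partial_op_def by blast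

lemma bounded_op_0: "bounded_op T \<Longrightarrow> T 0 = 0"
  by (simp add: bounded_op_def linear_simps)

lemma Rep_partial_op: "pinj f \<Longrightarrow> Rep_ell2 (partial_op f \<xi>) y = (case partial_inv f y of None \<Rightarrow> 0 | Some x \<Rightarrow> Rep_ell2 \<xi> x)"
  using partial_op_exists[of f] is_partial_op[of f] partial_op_ex1[of f] by metis

lemma partial_op_comp: "pinj f \<Longrightarrow> pinj g \<Longrightarrow> partial_op (f \<circ>\<^sub>m g) = partial_op f \<circ> partial_op g"
proof (rule bounded_op_eqI)
  fix x assume [simp]: "pinj f" "pinj g"
  show "partial_op (f \<circ>\<^sub>m g) (delta x) = (partial_op f \<circ> partial_op g) (delta x)"
    by (cases "g x") (auto simp: partial_op_delta pinj_comp bounded_op_0[OF bounded_partial_op])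
qed (auto intro!: bounded_partial_op pinj_comp bounded_op_compose)

lemma partial_op_adj:
  assumes f: "pinj f"
  shows "cinner (partial_op f \<xi>) \<eta> = cinner \<xi> (partial_op (partial_inv f) \<eta>)"
proof -
  let ?h = "\<lambda>x. cnj (Rep_ell2 \<xi> x) * Rep_ell2 (partial_op (partial_inv f) \<eta>) x"
  have "?h summable_on UNIV"
    using Rep_ell2[of \<xi>] Rep_ell2[of "partial_op (partial_inv f) \<eta>"]
    by (intro ell2_summable_mult) auto
  from partial_pullback(2)[OF f this]
  have "(\<Sum>\<^sub>\<infinity>y. case partial_inv f y of None \<Rightarrow> 0 | Some x \<Rightarrow> ?h x) = infsum ?h (dom f)" .
  moreover have "(case partial_inv f y of None \<Rightarrow> 0 | Some x \<Rightarrow> ?h x) = cnj (Rep_ell2 (partial_op f \<xi>) y) * Rep_ell2 \<eta> y" for y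
  proof (cases "partial_inv f y")
    case (Some x)
    then have "f x = Some y" using partial_inv_eq_Some[OF f] by simp
    then show ?thesis using Some by (simp add: Rep_partial_op f pinj_inv inv_inv)
  qed (simp add: Rep_partial_op f)
  moreover have "infsum ?h (dom f) = infsum ?h UNIV"
    by (rule infsum_cong_neutral) (auto simp: Rep_partial_op f pinj_inv inv_inv domIff)
  ultimately show ?thesis by (simp add: cinner.rep_eq)
qed

lemma delta_inj: "delta x = delta y \<longleftrightarrow> x = y"
proof
  assume "delta x = delta y"
  then have "Rep_ell2 (delta x) x = Rep_ell2 (delta y) x" by simp
  then show "x = y" by (simp add: delta.rep_eq split: if_splits)
qed simp

lemma delta_nz: "delta x \<noteq> 0"
proof
  assume "delta x = 0"
  then have "Rep_ell2 (delta x) x = Rep_ell2 0 x" by simp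
  then show False by (simp add: delta.rep_eq zero_ell2.rep_eq)
qed

lemma cinner_eqI: assumes "\<And>\<xi>. cinner \<xi> \<eta> = cinner \<xi> \<zeta>" shows "\<eta> = \<zeta>"
proof -
  have "inner \<xi> (\<eta> - \<zeta>) = 0" for \<xi> unfolding inner_diff_right by (simp add: inner_ell2_def assms)
  from this[of "\<eta> - \<zeta>"] show ?thesis by simp
qed

primrec peval :: "'a::monoid_mult iterm \<Rightarrow> 'a \<Rightarrow> 'a option" where
  "peval (Gen p) = left_trans p"
| "peval (Mul s t) = peval s \<circ>\<^sub>m peval t"
| "peval (Star s) = partial_inv (peval s)"

context
  assumes left_cancel: "\<And>a b c :: 'a::monoid_mult. a * b = a * c \<Longrightarrow> b = c"
begin

lemma pinj_left: "pinj (left_trans (a::'a))"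
  by (rule pinjI) (auto simp: left_trans_def dest: left_cancel)

lemma pinj_peval: "pinj (peval (t :: 'a iterm))"
  by (induction t) (auto intro: pinj_comp pinj_inv pinj_left)

lemma pe[simp]: "partial_inv (peval (t :: 'a iterm)) y = Some x \<longleftrightarrow> peval t x = Some y"
  by (rule partial_inv_eq_Some) (rule pinj_peval)

lemma pe2[simp]: "partial_inv (partial_inv (peval (t :: 'a iterm))) = peval t"
  by (rule inv_inv) (rule pinj_peval)

lemma pe3[simp]: "partial_inv (peval s \<circ>\<^sub>m peval (t :: 'a iterm)) y = Some x \<longleftrightarrow> (peval s \<circ>\<^sub>m peval t) x = Some y"
  by (rule partial_inv_eq_Some) (intro pinj_comp pinj_peval)

lemma pe4[simp]: "partial_inv (left_trans (p :: 'a)) y = Some x \<longleftrightarrow> left_trans p x = Some y"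
  by (rule partial_inv_eq_Some) (rule pinj_left)

lemma univ_rel_peval: "univ_rel s t \<Longrightarrow> peval s = peval (t :: 'a iterm)"
proof (induction rule: univ_rel.induct)
  case (proj_commute s t)
  show ?case
    by (rule map_eqI) (auto simp: map_comp_Some_iff, (metis pinj_peval pinjD option.inject)+)
next
  case (regular s)
  show ?case by (rule map_eqI) (auto simp: map_comp_Some_iff dest: pinjD[OF pinj_peval])
next
  case (assoc s t u)
  show ?case by (rule map_eqI) (auto simp: map_comp_Some_iff)
next
  case (Star_Mul s t)
  show ?case by (rule map_eqI) (auto simp: map_comp_Some_iff)
next
  case (Gen_Mul p q)
  show ?case by (rule map_eqI) (auto simp: map_comp_Some_iff left_trans_def mult.assoc)
next
  case (Gen_isometry p)
  show ?case by (rule map_eqI) (auto simp: map_comp_Some_iff left_trans_def dest: left_cancel)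
next
  case (unit_left p)
  show ?case by (rule map_eqI) (auto simp: map_comp_Some_iff left_trans_def)
next
  case (unit_right p)
  show ?case by (rule map_eqI) (auto simp: map_comp_Some_iff left_trans_def)
qed auto

definition V0 :: "'a univ_inv \<Rightarrow> 'a ell2 \<Rightarrow> 'a ell2" where
  "V0 x = partial_op (peval (rep_univ_inv x))"

lemma rep_abs: "univ_rel (rep_univ_inv (abs_univ_inv t)) (t :: 'a iterm)"
  using Quotient_rep_abs[OF Quotient_univ_inv] univ_rel.refl by blast

lemma V0_abs: "V0 (abs_univ_inv t) = partial_op (peval t)"
  unfolding V0_def using univ_rel_peval[OF rep_abs[of t]] by simp

lemma abs_cases: obtains t where "x = abs_univ_inv (t :: 'a iterm)"
  using Quotient_abs_rep[OF Quotient_univ_inv, of x] by metis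

lemma induced_V0: "is_induced_rep V0"
  unfolding is_induced_rep_def star_rep_def
proof (intro conjI allI)
  fix x y :: "'a univ_inv" and \<xi> \<eta> :: "'a ell2"
  obtain s t where [simp]: "x = abs_univ_inv s" "y = abs_univ_inv t" using abs_cases by metis
  show "bounded_op (V0 x)" by (simp add: V0_abs bounded_partial_op pinj_peval)
  show "V0 (x * y) = V0 x \<circ> V0 y"
    by (simp add: times_univ_inv.abs_eq V0_abs partial_op_comp pinj_peval)
  show "cinner (V0 x \<xi>) \<eta> = cinner \<xi> (V0 (star x) \<eta>)"
    by (simp add: star_univ_inv.abs_eq V0_abs partial_op_adj pinj_peval)
next
  show "V0 1 = id"
    unfolding one_univ_inv_def V0_abs
  proof (rule bounded_op_eqI)
    show "bounded_op (partial_op (peval (Gen (1::'a))))" by (rule bounded_partial_op) (rule pinj_peval)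
    show "bounded_op (id :: 'a ell2 \<Rightarrow> _)" by (simp add: bounded_op_def id_def bounded_linear_ident)
    show "partial_op (peval (Gen (1::'a))) (delta x) = id (delta x)" for x
      by (subst partial_op_delta[OF pinj_peval]) (simp add: left_trans_def)
  qed
next
  fix p q :: 'a
  show "V0 (v p) (delta q) = delta (p * q)"
    by (simp add: v.abs_eq V0_abs partial_op_delta pinj_left) (simp add: left_trans_def)
qed

lemma induced_unique: 
  assumes p: "is_induced_rep \<pi>" and r: "is_induced_rep \<rho>" shows "\<pi> = (\<rho> :: 'a univ_inv \<Rightarrow> _)"
proof
  fix x :: "'a univ_inv"
  have "\<pi> (abs_univ_inv t) = \<rho> (abs_univ_inv t)" for t :: "'a iterm"
  proof (induction t)
    case (Gen q)
    show ?case unfolding v.abs_eq[symmetric]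
      by (rule bounded_op_eqI) (use p r in \<open>auto simp: is_induced_rep_def star_rep_def\<close>)
  next
    case (Mul s t)
    then show ?case using p r
      unfolding times_univ_inv.abs_eq[symmetric] is_induced_rep_def star_rep_def by simp
  next
    case (Star s)
    show ?case
    proof (rule ext, rule cinner_eqI)
      fix \<eta> \<xi>
      show "cinner \<xi> (\<pi> (abs_univ_inv (Star s)) \<eta>) = cinner \<xi> (\<rho> (abs_univ_inv (Star s)) \<eta>)"
        using p r Star
        unfolding star_univ_inv.abs_eq[symmetric] is_induced_rep_def star_rep_def by metis
    qed
  qed
  then show "\<pi> x = \<rho> x" using abs_cases by metis
qed

lemma induced_eq: "induced_rep = V0"
  unfolding induced_rep_def by (rule the_equality) (auto intro: induced_V0 induced_unique)

lemma induced_rep_ex1: "\<exists>!\<pi> :: 'a univ_inv \<Rightarrow> _. is_induced_rep \<pi>"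
  using induced_V0 induced_unique by blast

end

end

(* For x in S^* and s in S, the vector delta_(v_s) lies in the initial space of V_x if and only if
   the partial bijection of S defined by x is defined at s, and then x v_s = v_(x(s)). Existence of
   x(s) gives x^* x v_s = v_s by induction on a word for x; conversely, letting the relation
   x^* x v_s = v_s act on the point 1 of S shows that x(s) exists. *)

theory Submission
  imports Defs
begin

text \<open>On the vectors fixed by \<open>star x * x\<close>, multiplying \<open>x * t\<close> by
  \<open>star x\<close> recovers \<open>t\<close>. This makes the definite description behind
  \<open>left_regular\<close> denote an actual operator.\<close>

lemma pinj_left_regular:
  fixes x :: "'p::inverse_semigroup"
  shows "pinj (\<lambda>t. if star x * x * t = t then Some (x * t) else None)"
  by (rule pinjI) (metis mult.assoc option.distinct(1) option.inject)

lemma left_regular_delta: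
  "left_regular x (delta t) = (if star x * x * t = t then delta (x * t) else 0)"
  unfolding left_regular_def by (simp add: partial_op_delta[OF pinj_left_regular])

lemma bounded_left_regular: "bounded_op (left_regular x)"
  unfolding left_regular_def by (rule bounded_partial_op[OF pinj_left_regular])

lemma v_mult: "v p * v q = v (p * q)"
  by transfer (rule univ_rel.Gen_Mul)

lemma star_v_mult_v: "star (v p) * v p = 1"
  by transfer (rule univ_rel.Gen_isometry)

lemma star_mult: "star (a * b) = star b * star (a :: 'a::monoid_mult univ_inv)"
  by transfer (rule univ_rel.Star_Mul)

lemma star_star: "star (star a) = (a :: 'a::monoid_mult univ_inv)"
  by transfer (rule univ_rel.Star_Star)

text \<open>An injective map merely relocates the coefficients of a vector, and a total one discards
  none, so the sum of squares survives reindexing. Applied to \<open>v\<close>, this makes the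
  embedding isometric.\<close>

lemma norm_partial_op_total:
  assumes "pinj f" "dom f = UNIV"
  shows "norm (partial_op f \<xi>) = norm \<xi>"
proof -
  let ?h = "\<lambda>x. (cmod (Rep_ell2 \<xi> x))\<^sup>2"
  have s: "?h summable_on UNIV" using Rep_ell2[of \<xi>] by simp
  have "(norm (partial_op f \<xi>))\<^sup>2 = (\<Sum>\<^sub>\<infinity>y. case partial_inv f y of None \<Rightarrow> 0 | Some x \<Rightarrow> ?h x)"
    unfolding norm_ell2_sq
    by (rule infsum_cong) (simp add: Rep_partial_op[OF assms(1)] split: option.splits)
  also have "\<dots> = (norm \<xi>)\<^sup>2"
    unfolding norm_ell2_sq using partial_pullback(2)[OF assms(1) s] assms(2) by simp
  finally show ?thesis by simp
qed

lemma abs_univ_inv_surj: obtains t where "x = abs_univ_inv (t :: 'a::monoid_mult iterm)"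
  using Quotient_abs_rep[OF Quotient_univ_inv, of x] by metis

lemma left_inverse_hull_eq: "left_inverse_hull = range (peval :: 'a::monoid_mult iterm \<Rightarrow> _)"
proof
  show "left_inverse_hull \<subseteq> range (peval :: 'a iterm \<Rightarrow> _)"
  proof
    fix f :: "'a \<Rightarrow> 'a option"
    assume "f \<in> left_inverse_hull"
    then show "f \<in> range peval"
    proof induction
      case (left_trans a)
      show ?case by (rule range_eqI[of _ _ "Gen a"]) simp
    next
      case (inverse f)
      then obtain t where "f = peval t" by blast
      then show ?case by (intro range_eqI[of _ _ "Star t"]) simp
    next
      case (comp f g)
      then obtain t u where "f = peval t" "g = peval u" by blast
      then show ?case by (intro range_eqI[of _ _ "Mul t u"]) simp
    qed
  qed
  have "peval t \<in> left_inverse_hull" for t :: "'a iterm"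
    by (induction t) (auto intro: left_inverse_hull.intros)
  then show "range (peval :: 'a iterm \<Rightarrow> _) \<subseteq> left_inverse_hull" by blast
qed

context
  assumes left_cancel: "\<And>a b c :: 'a::monoid_mult. a * b = a * c \<Longrightarrow> b = c"
begin

lemma pinj_term: "pinj (peval (t :: 'a iterm))"
  by (rule pinj_peval) (metis left_cancel)

lemma star_rep_induced_rep: "star_rep (induced_rep :: 'a univ_inv \<Rightarrow> _)"
proof -
  have "\<exists>!\<pi> :: 'a univ_inv \<Rightarrow> _. is_induced_rep \<pi>"
    by (rule induced_rep_ex1) (metis left_cancel)
  from theI'[OF this] show ?thesis
    by (simp add: induced_rep_def is_induced_rep_def)
qed

lemma induced_rep_abs: "induced_rep (abs_univ_inv t) = partial_op (peval (t :: 'a iterm))"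
proof -
  have "induced_rep = (V0 :: 'a univ_inv \<Rightarrow> _)"
    by (rule induced_eq) (metis left_cancel)
  moreover have "V0 (abs_univ_inv t) = partial_op (peval t)"
    by (rule V0_abs) (metis left_cancel)
  ultimately show ?thesis by simp
qed

text \<open>The partial bijections of S satisfy all the defining relations of the universal inverse
  semigroup, so a word acts on S through its class alone. This is how equations between classes
  yield facts about S.\<close>

lemma peval_cong: "abs_univ_inv s = abs_univ_inv t \<Longrightarrow> peval s = peval (t :: 'a iterm)"
  by (rule univ_rel_peval[rotated]) (simp add: univ_inv.abs_eq_iff, metis left_cancel)

text \<open>The two equations are proved in one induction because passing from a word to its star
  exchanges them. Together they give \<open>star x * x * v s = v s\<close> for the class
  \<open>x\<close> of \<open>t\<close>.\<close>

lemma peval_SomeD: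
  fixes t :: "'a iterm"
  assumes "peval t s = Some r"
  shows "abs_univ_inv t * v s = v r" "star (abs_univ_inv t) * v r = v s"
proof -
  have "abs_univ_inv t * v s = v r \<and> star (abs_univ_inv t) * v r = v s"
    using assms
  proof (induction t arbitrary: s r)
    case (Gen p)
    then have "r = p * s" by (simp add: left_trans_def)
    \<comment> \<open>The isometry relation cancels \<open>v p\<close> in the second
      equation.\<close>
    moreover have "star (v p) * (v p * v s) = v s"
      by (simp add: star_v_mult_v flip: mult.assoc)
    ultimately show ?case by (simp add: v_mult flip: v.abs_eq)
  next
    case (Mul t u)
    then obtain q where "peval u s = Some q" "peval t q = Some r"
      by (auto simp: map_comp_Some_iff)
    with Mul.IH show ?case
      by (simp add: mult.assoc star_mult flip: times_univ_inv.abs_eq)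
  next
    case (Star t)
    from Star.prems have "peval t r = Some s"
      by (simp add: partial_inv_eq_Some[OF pinj_term])
    from Star.IH[OF this] show ?case
      by (simp add: star_star flip: star_univ_inv.abs_eq)
  qed
  then show "abs_univ_inv t * v s = v r" "star (abs_univ_inv t) * v r = v s"
    by simp_all
qed

lemma peval_defined:
  fixes t :: "'a iterm"
  assumes "star (abs_univ_inv t) * abs_univ_inv t * v s = v s"
  shows "peval t s \<noteq> None"
proof -
  \<comment> \<open>Appending \<open>Gen s\<close> turns the hypothesis into an equation between
    words. Both sides can then be evaluated at 1, which \<open>Gen s\<close> sends to
    \<open>s\<close>; the left side next applies \<open>t\<close>, so a value there requires
    \<open>t\<close> to be defined at \<open>s\<close>.\<close>
  have "abs_univ_inv (Mul (Mul (Star t) t) (Gen s)) = abs_univ_inv (Gen s)"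
    using assms by (simp add: times_univ_inv.abs_eq star_univ_inv.abs_eq v.abs_eq)
  from peval_cong[OF this] have "peval (Mul (Mul (Star t) t) (Gen s)) 1 = Some s"
    by (simp add: left_trans_def)
  then show ?thesis by (auto simp: map_comp_Some_iff left_trans_def)
qed

text \<open>The class \<open>v s\<close> determines left translation by \<open>s\<close>, whose
  value at 1 is \<open>s\<close>.\<close>

lemma pinj_v: "pinj (\<lambda>s :: 'a. Some (v s))"
proof (rule pinjI)
  fix s s' :: 'a and y
  assume "Some (v s) = Some y" "Some (v s') = Some y"
  then have "abs_univ_inv (Gen s) = abs_univ_inv (Gen s')" by (simp add: v.abs_eq)
  from peval_cong[OF this] have "left_trans s 1 = left_trans s' 1" by simp
  then show "s = s'" by (simp add: left_trans_def)
qed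

lemma bounded_l2_embed: "bounded_op (l2_embed :: 'a ell2 \<Rightarrow> _)"
  unfolding l2_embed_def by (rule bounded_partial_op[OF pinj_v])

lemma l2_embed_delta: "l2_embed (delta s) = delta (v (s :: 'a))"
  by (simp add: l2_embed_def partial_op_delta[OF pinj_v])

lemma norm_l2_embed: "norm (l2_embed (\<xi> :: 'a ell2)) = norm \<xi>"
  unfolding l2_embed_def by (rule norm_partial_op_total[OF pinj_v]) auto

text \<open>A linear isometry has trivial kernel. Injectivity is what makes
  \<open>inv l2_embed\<close> a left inverse in \<open>restrict_rep\<close>.\<close>

lemma inj_l2_embed: "inj (l2_embed :: 'a ell2 \<Rightarrow> _)"
proof (rule injI)
  fix \<xi> \<eta> :: "'a ell2"
  assume "l2_embed \<xi> = l2_embed \<eta>"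
  moreover have "l2_embed (\<xi> - \<eta>) = l2_embed \<xi> - l2_embed \<eta>"
    using bounded_l2_embed by (simp add: bounded_op_def linear_simps)
  ultimately show "\<xi> = \<eta>" using norm_l2_embed[of "\<xi> - \<eta>"] by simp
qed

text \<open>The embedding intertwines the two representations, which yields both the invariance of
  its range and the identification of the restriction. Bounded operators are determined by their
  values on basis vectors, so comparing domains and values of the partial maps suffices.\<close>

lemma left_regular_comp_l2_embed:
  fixes x :: "'a univ_inv"
  shows "left_regular x \<circ> l2_embed = l2_embed \<circ> induced_rep x"
proof -
  obtain t where x: "x = abs_univ_inv t" by (rule abs_univ_inv_surj)
  have ind: "induced_rep x = partial_op (peval t)"
    by (simp add: x induced_rep_abs)
  show ?thesis
    unfolding ind
  proof (rule bounded_op_eqI)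
    show "bounded_op (left_regular x \<circ> (l2_embed :: 'a ell2 \<Rightarrow> _))"
      by (intro bounded_op_compose bounded_left_regular bounded_l2_embed)
    show "bounded_op (l2_embed \<circ> partial_op (peval t))"
      by (intro bounded_op_compose bounded_partial_op pinj_term bounded_l2_embed)
    fix s :: 'a
    show "(left_regular x \<circ> l2_embed) (delta s) = (l2_embed \<circ> partial_op (peval t)) (delta s)"
    proof (cases "peval t s")
      case None
      \<comment> \<open>Hence \<open>delta (v s)\<close> lies outside the initial space of
        \<open>left_regular x\<close>, and both sides vanish.\<close>
      then have "star x * x * v s \<noteq> v s"
        using peval_defined x by blast
      with None show ?thesis
        by (simp add: l2_embed_delta partial_op_delta pinj_term left_regular_delta
            bounded_op_0[OF bounded_l2_embed])
    next
      case (Some r)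
      then show ?thesis
        \<comment> \<open>Here \<open>star x * (x * v s) = star x * v r = v s\<close>, so the
          nonzero branch applies and both sides equal \<open>delta (v r)\<close>.\<close>
        using peval_SomeD[OF Some]
        by (simp add: l2_embed_delta partial_op_delta pinj_term left_regular_delta x mult.assoc)
    qed
  qed
qed

lemma left_regular_l2_embed:
  "left_regular x (l2_embed \<xi>) = l2_embed (induced_rep (x :: 'a univ_inv) \<xi>)"
  using left_regular_comp_l2_embed by (metis comp_apply)

lemma restrict_rep_left_regular:
  "restrict_rep (left_regular :: 'a univ_inv \<Rightarrow> _) = induced_rep"
  by (intro ext) (simp add: restrict_rep_def left_regular_l2_embed inj_l2_embed)

text \<open>Every element of the universal inverse semigroup is the class of a word, and the partial
  maps given by words are exactly the members of the hull.\<close>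

lemma range_induced_rep:
  "range (induced_rep :: 'a univ_inv \<Rightarrow> _) = partial_op ` left_inverse_hull"
proof -
  have "range (abs_univ_inv :: 'a iterm \<Rightarrow> _) = UNIV"
    using abs_univ_inv_surj by blast
  then have "range (induced_rep :: 'a univ_inv \<Rightarrow> _) = range (\<lambda>t. induced_rep (abs_univ_inv t))"
    by (metis image_image)
  then show ?thesis
    by (simp add: induced_rep_abs left_inverse_hull_eq image_image)
qed

end

theorem lemma4p7:
  assumes left_cancel: "\<And>a b c :: 'a::monoid_mult. a * b = a * c \<Longrightarrow> b = c"
  shows
    "(bounded_op (l2_embed :: 'a ell2 \<Rightarrow> 'a univ_inv ell2) \<and>
      (\<forall>\<xi> :: 'a ell2. norm (l2_embed \<xi>) = norm \<xi>) \<and>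
      (\<forall>s :: 'a. l2_embed (delta s) = delta (v s))) \<and>
     (\<forall>x :: 'a univ_inv. left_regular x ` range l2_embed \<subseteq> range l2_embed) \<and>
     star_rep (restrict_rep (left_regular :: 'a univ_inv \<Rightarrow> _)) \<and>
     restrict_rep (left_regular :: 'a univ_inv \<Rightarrow> _) = induced_rep \<and>
     range (restrict_rep (left_regular :: 'a univ_inv \<Rightarrow> _)) = partial_op ` left_inverse_hull"
proof -
  have restrict: "restrict_rep (left_regular :: 'a univ_inv \<Rightarrow> _) = induced_rep"
    by (rule restrict_rep_left_regular) (metis left_cancel)
  have "left_regular x (l2_embed \<xi>) = l2_embed (induced_rep x \<xi>)" for x :: "'a univ_inv" and \<xi>
    by (rule left_regular_l2_embed) (metis left_cancel)
  then have "left_regular x ` range l2_embed \<subseteq> range l2_embed" for x :: "'a univ_inv"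
    by auto
  moreover have "bounded_op (l2_embed :: 'a ell2 \<Rightarrow> _)"
    by (rule bounded_l2_embed) (metis left_cancel)
  moreover have "norm (l2_embed \<xi>) = norm \<xi>" for \<xi> :: "'a ell2"
    by (rule norm_l2_embed) (metis left_cancel)
  moreover have "l2_embed (delta s) = delta (v s)" for s :: 'a
    by (rule l2_embed_delta) (metis left_cancel)
  moreover have "star_rep (induced_rep :: 'a univ_inv \<Rightarrow> _)"
    by (rule star_rep_induced_rep) (metis left_cancel)
  moreover have "range (induced_rep :: 'a univ_inv \<Rightarrow> _) = partial_op ` left_inverse_hull"
    by (rule range_induced_rep) (metis left_cancel)
  ultimately show ?thesis
    unfolding restrict by blast
qed

end
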